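(* Let $(A,\cdot,\ast,\alpha)$ be a Hom-Novikov-Poisson algebra. Then $A$ is admissible if and only if it is left Hom-associative.
   Context: Everything is over a fixed field $\mathbf{k}$ of characteristic $0$. A double Hom-algebra is a quadruple $(A,\cdot,\ast,\alpha)$ where $A$ is a $\mathbf{k}$-vector space, $\cdot$ and $\ast$ are bilinear operations $A\otimes A\to A$, and $\alpha\colon A\to A$ is a linear map (the twisting map). A Hom-Novikov-Poisson algebra is a double Hom-algebra $(A,\cdot,\ast,\alpha)$ such that for all $x,y,z\in A$: (1) $(A,\cdot,\alpha)$ is a commutative Hom-associative algebra: $x\cdot y=y\cdot x$ and $(x\cdot y)\cdot\alpha(z)=\alpha(x)\cdot(y\cdot z)$; (2) $(A,\ast,\alpha)$ is a Hom-Novikov algebra: $(x\ast y)\ast\alpha(z)-\alpha(x)\ast(y\ast z)=(y\ast x)\ast\alpha(z)-\alpha(y)\ast(x\ast z)$ and $(x\ast y)\ast\alpha(z)=(x\ast z)\ast\alpha(y)$; (3) $(x\ast y)\cdot\alpha(z)-\alpha(x)\ast(y\cdot z)=(y\ast x)\cdot\alpha(z)-\alpha(y)\ast(x\cdot z)$; (4) $(x\cdot y)\ast\alpha(z)=(x\ast z)\cdot\alpha(y)$. A double Hom-algebra $(A,\cdot,\ast,\alpha)$ is left Hom-associative if $(x\cdot y)\ast\alpha(z)=\alpha(x)\ast(y\cdot z)$ for all $x,y,z\in A$. A Hom-Lie algebra $(A,[,],\alpha)$ is a vector space with a bilinear anti-symmetric bracket and a linear map $\alpha$ satisfying the Hom-Jacobi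 identity $[[x,y],\alpha(z)]+[[z,x],\alpha(y)]+[[y,z],\alpha(x)]=0$. A Hom-Poisson algebra $(A,\cdot,[,],\alpha)$ consists of a commutative Hom-associative algebra $(A,\cdot,\alpha)$ and a Hom-Lie algebra $(A,[,],\alpha)$ such that the Hom-Leibniz identity $[\alpha(x),y\cdot z]=[x,y]\cdot\alpha(z)+\alpha(y)\cdot[x,z]$ holds for all $x,y,z\in A$. A Hom-Novikov-Poisson algebra $(A,\cdot,\ast,\alpha)$ is admissible if $A^-=(A,\cdot,[,],\alpha)$ is a Hom-Poisson algebra, where $[x,y]=x\ast y-y\ast x$. *)

theory Defs
  imports Complex_Main
begin

text \<open>
  The underlying vector space of an algebra is a type of class \<open>ab_group_add\<close> together with a
  scalar multiplication satisfying \<open>vector_space\<close>; the whole type is the carrier. The scalars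
  range over an arbitrary field of characteristic 0. The twisting map \<open>\<alpha>\<close> is only required to be
  linear, not multiplicative.
\<close>

definition bilinear_op ::
    "('k::field_char_0 \<Rightarrow> 'a::ab_group_add \<Rightarrow> 'a) \<Rightarrow> ('a \<Rightarrow> 'a \<Rightarrow> 'a) \<Rightarrow> bool" where
  "bilinear_op scale f \<longleftrightarrow>
     (\<forall>x. Vector_Spaces.linear scale scale (\<lambda>y. f x y)) \<and>
     (\<forall>y. Vector_Spaces.linear scale scale (\<lambda>x. f x y))"

locale hom_algebra = vector_space scale
  for scale :: "'k::field_char_0 \<Rightarrow> 'a::ab_group_add \<Rightarrow> 'a" +
  fixes mult :: "'a \<Rightarrow> 'a \<Rightarrow> 'a"
    and \<alpha> :: "'a \<Rightarrow> 'a"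
  assumes bilinear_mult: "bilinear_op scale mult"
    and linear_twist: "Vector_Spaces.linear scale scale \<alpha>"

locale double_hom_algebra =
  dot: hom_algebra scale dot \<alpha> + star: hom_algebra scale star \<alpha>
  for scale :: "'k::field_char_0 \<Rightarrow> 'a::ab_group_add \<Rightarrow> 'a"
    and dot :: "'a \<Rightarrow> 'a \<Rightarrow> 'a" (infixl "\<cdot>" 70)
    and star :: "'a \<Rightarrow> 'a \<Rightarrow> 'a" (infixl "\<star>" 70)
    and \<alpha> :: "'a \<Rightarrow> 'a"

locale comm_hom_associative_algebra = hom_algebra scale dot \<alpha>
  for scale :: "'k::field_char_0 \<Rightarrow> 'a::ab_group_add \<Rightarrow> 'a"
    and dot :: "'a \<Rightarrow> 'a \<Rightarrow> 'a" (infixl "\<cdot>" 70)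
    and \<alpha> :: "'a \<Rightarrow> 'a" +
  assumes commutative: "x \<cdot> y = y \<cdot> x"
    and hom_associative: "(x \<cdot> y) \<cdot> \<alpha> z = \<alpha> x \<cdot> (y \<cdot> z)"

locale hom_novikov_algebra = hom_algebra scale star \<alpha>
  for scale :: "'k::field_char_0 \<Rightarrow> 'a::ab_group_add \<Rightarrow> 'a"
    and star :: "'a \<Rightarrow> 'a \<Rightarrow> 'a" (infixl "\<star>" 70)
    and \<alpha> :: "'a \<Rightarrow> 'a" +
  assumes left_symmetric:
      "(x \<star> y) \<star> \<alpha> z - \<alpha> x \<star> (y \<star> z) = (y \<star> x) \<star> \<alpha> z - \<alpha> y \<star> (x \<star> z)"
    and right_commutative: "(x \<star> y) \<star> \<alpha> z = (x \<star> z) \<star> \<alpha> y"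

locale hom_novikov_poisson_algebra =
  double_hom_algebra scale dot star \<alpha> +
  comm_hom_associative_algebra scale dot \<alpha> +
  hom_novikov_algebra scale star \<alpha>
  for scale :: "'k::field_char_0 \<Rightarrow> 'a::ab_group_add \<Rightarrow> 'a"
    and dot :: "'a \<Rightarrow> 'a \<Rightarrow> 'a" (infixl "\<cdot>" 70)
    and star :: "'a \<Rightarrow> 'a \<Rightarrow> 'a" (infixl "\<star>" 70)
    and \<alpha> :: "'a \<Rightarrow> 'a" +
  assumes left_compatible:
      "(x \<star> y) \<cdot> \<alpha> z - \<alpha> x \<star> (y \<cdot> z) = (y \<star> x) \<cdot> \<alpha> z - \<alpha> y \<star> (x \<cdot> z)"
    and right_compatible: "(x \<cdot> y) \<star> \<alpha> z = (x \<star> z) \<cdot> \<alpha> y"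

locale left_hom_associative_algebra = double_hom_algebra scale dot star \<alpha>
  for scale :: "'k::field_char_0 \<Rightarrow> 'a::ab_group_add \<Rightarrow> 'a"
    and dot :: "'a \<Rightarrow> 'a \<Rightarrow> 'a" (infixl "\<cdot>" 70)
    and star :: "'a \<Rightarrow> 'a \<Rightarrow> 'a" (infixl "\<star>" 70)
    and \<alpha> :: "'a \<Rightarrow> 'a" +
  assumes left_hom_associative: "(x \<cdot> y) \<star> \<alpha> z = \<alpha> x \<star> (y \<cdot> z)"

locale hom_lie_algebra = hom_algebra scale bracket \<alpha>
  for scale :: "'k::field_char_0 \<Rightarrow> 'a::ab_group_add \<Rightarrow> 'a"
    and bracket :: "'a \<Rightarrow> 'a \<Rightarrow> 'a"
    and \<alpha> :: "'a \<Rightarrow> 'a" +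
  assumes antisymmetric: "bracket x y = - bracket y x"
    and hom_jacobi:
      "bracket (bracket x y) (\<alpha> z) + bracket (bracket z x) (\<alpha> y)
        + bracket (bracket y z) (\<alpha> x) = 0"

locale hom_poisson_algebra =
  comm_hom_associative_algebra scale dot \<alpha> + lie: hom_lie_algebra scale bracket \<alpha>
  for scale :: "'k::field_char_0 \<Rightarrow> 'a::ab_group_add \<Rightarrow> 'a"
    and dot :: "'a \<Rightarrow> 'a \<Rightarrow> 'a" (infixl "\<cdot>" 70)
    and bracket :: "'a \<Rightarrow> 'a \<Rightarrow> 'a"
    and \<alpha> :: "'a \<Rightarrow> 'a" +
  assumes hom_leibniz: "bracket (\<alpha> x) (y \<cdot> z) = bracket x y \<cdot> \<alpha> z + \<alpha> y \<cdot> bracket x z"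

definition commutator_bracket ::
    "('a::ab_group_add \<Rightarrow> 'a \<Rightarrow> 'a) \<Rightarrow> 'a \<Rightarrow> 'a \<Rightarrow> 'a" where
  "commutator_bracket star x y = star x y - star y x"

locale admissible_hom_novikov_poisson_algebra =
  hom_novikov_poisson_algebra scale dot star \<alpha> +
  minus: hom_poisson_algebra scale dot "commutator_bracket star" \<alpha>
  for scale :: "'k::field_char_0 \<Rightarrow> 'a::ab_group_add \<Rightarrow> 'a"
    and dot :: "'a \<Rightarrow> 'a \<Rightarrow> 'a" (infixl "\<cdot>" 70)
    and star :: "'a \<Rightarrow> 'a \<Rightarrow> 'a" (infixl "\<star>" 70)
    and \<alpha> :: "'a \<Rightarrow> 'a"

end

theory Submission
  imports Defs
begin

text \<open>
  The Hom-Leibniz identity is the only axiom of a Hom-Poisson algebra that is not automatic for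
  \<open>A\<^sup>-\<close>: the commutative Hom-associative part is given, anti-symmetry is clear, and the
  Hom-Jacobi identity follows from left symmetry, as for a left-symmetric product without a twist.

  Fix \<open>x, y, z\<close> and put \<open>a = (y \<cdot> z) \<star> \<alpha> x\<close>, \<open>b = (x \<cdot> z) \<star> \<alpha> y\<close>, \<open>c = (x \<cdot> y) \<star> \<alpha> z\<close> and
  \<open>P = \<alpha> x \<star> (y \<cdot> z)\<close>, \<open>Q = \<alpha> y \<star> (x \<cdot> z)\<close>. Right compatibility turns \<open>(u \<star> v) \<cdot> \<alpha> w\<close>,
  for any arrangement \<open>u, v, w\<close> of \<open>x, y, z\<close>, into one of \<open>a, b, c\<close>. In these terms

    \<^item> the Hom-Leibniz identity at \<open>(x, y, z)\<close> is \<open>P + a = b + c\<close>, and at \<open>(y, x, z)\<close> it is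
      \<open>Q + b = a + c\<close> (lemma \<open>hom_leibniz_iff\<close>);
    \<^item> left compatibility is \<open>P + a = Q + b\<close> (lemma \<open>left_compatible_sums\<close>);
    \<^item> left Hom-associativity is \<open>P = c\<close>.

  The Hom-Leibniz identity and left compatibility give \<open>b + c = a + c\<close>, so \<open>a = b\<close> and
  \<open>P = c\<close>. Conversely, left Hom-associativity together with commutativity makes all five elements
  equal, so the Hom-Leibniz identity holds.
\<close>

lemma bilinear_op_commutator_bracket:
  assumes "vector_space scale" and "bilinear_op scale f"
  shows "bilinear_op scale (commutator_bracket f)"
proof -
  interpret vector_space_pair scale scale
    using assms(1) by (simp add: vector_space_pair_def)
  show ?thesis
    using assms(2) unfolding bilinear_op_def commutator_bracket_def
    by (auto intro: linear_compose_sub)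
qed

context hom_novikov_algebra
begin

lemma star_diff_left: "(x - y) \<star> z = x \<star> z - y \<star> z"
  using bilinear_mult unfolding bilinear_op_def
  by (meson module_hom.diff Vector_Spaces.linear.axioms(3))

lemma star_diff_right: "x \<star> (y - z) = x \<star> y - x \<star> z"
  using bilinear_mult unfolding bilinear_op_def
  by (meson module_hom.diff Vector_Spaces.linear.axioms(3))

text \<open>
  Left symmetry rewrites \<open>[x, y] \<star> \<alpha> z\<close> as \<open>\<alpha> x \<star> (y \<star> z) - \<alpha> y \<star> (x \<star> z)\<close>. The Hom-Jacobi
  sum is then a combination of products \<open>\<alpha> u \<star> (v \<star> w)\<close> in which every term occurs once with
  each sign.
\<close>

lemma hom_lie_algebra_commutator_bracket:
  "hom_lie_algebra scale (commutator_bracket (\<star>)) \<alpha>"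
proof (intro hom_lie_algebra.intro hom_algebra.intro hom_algebra_axioms.intro
    hom_lie_algebra_axioms.intro)
  show "vector_space scale"
    by (rule vector_space_axioms)
  show "Vector_Spaces.linear scale scale \<alpha>"
    by (rule linear_twist)
  show "bilinear_op scale (commutator_bracket (\<star>))"
    using vector_space_axioms bilinear_mult by (rule bilinear_op_commutator_bracket)
  show "commutator_bracket (\<star>) x y = - commutator_bracket (\<star>) y x" for x y
    by (simp add: commutator_bracket_def)
  have bracket_star: "commutator_bracket (\<star>) x y \<star> \<alpha> z = \<alpha> x \<star> (y \<star> z) - \<alpha> y \<star> (x \<star> z)"
    for x y z
    using left_symmetric[of x y z] by (simp add: commutator_bracket_def star_diff_left algebra_simps)
  have double_bracket: "commutator_bracket (\<star>) (commutator_bracket (\<star>) x y) (\<alpha> z) =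
      \<alpha> x \<star> (y \<star> z) - \<alpha> y \<star> (x \<star> z) - (\<alpha> z \<star> (x \<star> y) - \<alpha> z \<star> (y \<star> x))" for x y z
    unfolding bracket_star[symmetric] by (simp add: commutator_bracket_def star_diff_right)
  show "commutator_bracket (\<star>) (commutator_bracket (\<star>) x y) (\<alpha> z)
      + commutator_bracket (\<star>) (commutator_bracket (\<star>) z x) (\<alpha> y)
      + commutator_bracket (\<star>) (commutator_bracket (\<star>) y z) (\<alpha> x) = 0" for x y z
    by (simp add: double_bracket)
qed

end

context hom_novikov_poisson_algebra
begin

lemma dot_diff_left: "(x - y) \<cdot> z = x \<cdot> z - y \<cdot> z"
  using dot.bilinear_mult unfolding bilinear_op_def
  by (meson module_hom.diff Vector_Spaces.linear.axioms(3))

lemma admissible_iff_hom_leibniz: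
  "admissible_hom_novikov_poisson_algebra scale (\<cdot>) (\<star>) \<alpha> \<longleftrightarrow>
   (\<forall>x y z. commutator_bracket (\<star>) (\<alpha> x) (y \<cdot> z) =
      commutator_bracket (\<star>) x y \<cdot> \<alpha> z + \<alpha> y \<cdot> commutator_bracket (\<star>) x z)"
  using hom_novikov_poisson_algebra_axioms comm_hom_associative_algebra_axioms
    hom_lie_algebra_commutator_bracket
  by (auto simp: admissible_hom_novikov_poisson_algebra_def hom_poisson_algebra_def
      hom_poisson_algebra_axioms_def)

text \<open>
  Right compatibility and commutativity identify both \<open>(y \<star> x) \<cdot> \<alpha> z\<close> and \<open>\<alpha> y \<cdot> (z \<star> x)\<close> with
  \<open>(y \<cdot> z) \<star> \<alpha> x\<close>. That element occurs negatively once on the left and twice on the right of the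
  Hom-Leibniz identity, which leaves one copy after cancellation.
\<close>

lemma hom_leibniz_iff:
  "commutator_bracket (\<star>) (\<alpha> x) (y \<cdot> z) =
     commutator_bracket (\<star>) x y \<cdot> \<alpha> z + \<alpha> y \<cdot> commutator_bracket (\<star>) x z \<longleftrightarrow>
   \<alpha> x \<star> (y \<cdot> z) + (y \<cdot> z) \<star> \<alpha> x = (x \<cdot> z) \<star> \<alpha> y + (x \<cdot> y) \<star> \<alpha> z"
proof -
  have first: "commutator_bracket (\<star>) x y \<cdot> \<alpha> z = (x \<cdot> z) \<star> \<alpha> y - (y \<cdot> z) \<star> \<alpha> x"
    by (simp add: commutator_bracket_def dot_diff_left right_compatible)
  have "\<alpha> y \<cdot> commutator_bracket (\<star>) x z = commutator_bracket (\<star>) x z \<cdot> \<alpha> y"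
    by (rule commutative)
  also have "\<dots> = (x \<cdot> y) \<star> \<alpha> z - (z \<cdot> y) \<star> \<alpha> x"
    by (simp add: commutator_bracket_def dot_diff_left right_compatible)
  finally have second: "\<alpha> y \<cdot> commutator_bracket (\<star>) x z = (x \<cdot> y) \<star> \<alpha> z - (y \<cdot> z) \<star> \<alpha> x"
    by (simp add: commutative)
  show ?thesis
    unfolding first second by (simp add: commutator_bracket_def algebra_simps)
qed

lemma left_compatible_sums:
  "\<alpha> x \<star> (y \<cdot> z) + (y \<cdot> z) \<star> \<alpha> x = \<alpha> y \<star> (x \<cdot> z) + (x \<cdot> z) \<star> \<alpha> y"
  using left_compatible[of x y z] right_compatible[of x z y] right_compatible[of y z x]
  by (simp add: algebra_simps)

lemma left_hom_associative_iff:
  "left_hom_associative_algebra scale (\<cdot>) (\<star>) \<alpha> \<longleftrightarrow>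
   (\<forall>x y z. (x \<cdot> y) \<star> \<alpha> z = \<alpha> x \<star> (y \<cdot> z))"
  using double_hom_algebra_axioms
  by (simp add: left_hom_associative_algebra_def left_hom_associative_algebra_axioms_def)

end

theorem theorem5p5:
  fixes scale :: "'k::field_char_0 \<Rightarrow> 'a::ab_group_add \<Rightarrow> 'a"
    and dot star :: "'a \<Rightarrow> 'a \<Rightarrow> 'a"
    and \<alpha> :: "'a \<Rightarrow> 'a"
  assumes "hom_novikov_poisson_algebra scale dot star \<alpha>"
  shows "admissible_hom_novikov_poisson_algebra scale dot star \<alpha> \<longleftrightarrow>
         left_hom_associative_algebra scale dot star \<alpha>"
proof -
  interpret hom_novikov_poisson_algebra scale dot star \<alpha>
    by (rule assms)
  show ?thesis
    unfolding admissible_iff_hom_leibniz hom_leibniz_iff left_hom_associative_iff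
  proof (intro iffI allI)
    fix x y z
    assume leibniz: "\<forall>x y z. star (\<alpha> x) (dot y z) + star (dot y z) (\<alpha> x) =
      star (dot x z) (\<alpha> y) + star (dot x y) (\<alpha> z)"
    have at_x: "star (\<alpha> x) (dot y z) + star (dot y z) (\<alpha> x) =
        star (dot x z) (\<alpha> y) + star (dot x y) (\<alpha> z)"
      using leibniz by blast
    have "star (\<alpha> y) (dot x z) + star (dot x z) (\<alpha> y) =
        star (dot y z) (\<alpha> x) + star (dot x y) (\<alpha> z)"
      using leibniz commutative[of x y] by metis
    then have "star (dot y z) (\<alpha> x) = star (dot x z) (\<alpha> y)"
      using at_x left_compatible_sums[of x y z] by simp
    with at_x show "star (dot x y) (\<alpha> z) = star (\<alpha> x) (dot y z)"
      by (simp add: add.commute)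
  next
    fix x y z
    assume assoc: "\<forall>x y z. star (dot x y) (\<alpha> z) = star (\<alpha> x) (dot y z)"
    have "star (dot x z) (\<alpha> y) = star (\<alpha> x) (dot y z)"
      using assoc commutative[of z y] by metis
    moreover have "star (dot y z) (\<alpha> x) = star (dot x y) (\<alpha> z)"
      using assoc commutative[of x y] commutative[of x z] by metis
    ultimately show "star (\<alpha> x) (dot y z) + star (dot y z) (\<alpha> x) =
        star (dot x z) (\<alpha> y) + star (dot x y) (\<alpha> z)"
      by simp
  qed
qed

end
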